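(* Let $k \ge 1$, $r = (r_1,\ldots,r_k) \in \mathbb{Z}_{\ge 0}^k$ and $w = (w_1,\ldots,w_k) \in \mathbb{Z}_{\ge 1}^k$ satisfy $r_1/w_1 \le \cdots \le r_k/w_k$ and $0 \le r_1 < w_1$. Let $W = \max\{w_1,\ldots,w_k\}$, $R = \max\{r_1,\ldots,r_k\}$, and for an integer $n$ let $P_n = \langle w_1 n + r_1, \ldots, w_k n + r_k\rangle$. Suppose $n > w_1^2 W R^2$, and let $z$ and $z'$ be factorizations of a Betti element $\beta \in P_n$ lying in different connected components of $\nabla_\beta$, with $|z|_w > |z'|_w$. Then (a) the connected components of $z$ and $z'$ in $\nabla_\beta$ contain every factorization of $\beta$ of weighted length $|z|_w$ and $|z'|_w$, respectively; (b) some factorization $y$ of $\beta$ with $|y|_w = |z|_w$ has $y_1 > 0$; and (c) some factorization $y'$ of $\beta$ with $|y'|_w = |z'|_w$ has $y_k' > 0$.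
   Context: $\langle g_1,\ldots,g_k\rangle = \{z_1 g_1 + \cdots + z_k g_k : z_i \in \mathbb{Z}_{\ge 0}\}$. A factorization of $\beta \in P_n$ is a vector $z \in \mathbb{Z}_{\ge 0}^k$ with $\beta = \sum_{i=1}^k z_i(w_i n + r_i)$; $\mathsf{Z}(\beta)$ is the set of all factorizations of $\beta$. The weighted length of $z$ is $|z|_w = w_1 z_1 + \cdots + w_k z_k$. The factorization graph $\nabla_\beta$ has vertex set $\mathsf{Z}(\beta)$, with $z,z'$ joined by an edge whenever $z_i>0$ and $z_i'>0$ for some $i$. The element $\beta$ is a Betti element of $P_n$ if $\nabla_\beta$ is disconnected. The conditions on $r$ and $w$ in the claim are the paper's standing normalizations. *)

theory Defs
  imports Complex_Main "Graph_Theory.Digraph_Component"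
begin

text \<open>
  A vector indexed by \<open>1, \<dots>, k\<close> is a function on \<open>nat\<close>. Only the values on \<open>{1..k}\<close> are
  used; factorizations are normalized to be \<open>0\<close> elsewhere, so that they are determined by
  their entries on \<open>{1..k}\<close>.
\<close>

definition generated_monoid :: "nat \<Rightarrow> (nat \<Rightarrow> int) \<Rightarrow> int set" where
  "generated_monoid k g = {\<Sum>i=1..k. int (z i) * g i | z :: nat \<Rightarrow> nat. True}"

definition factorizations :: "nat \<Rightarrow> (nat \<Rightarrow> int) \<Rightarrow> int \<Rightarrow> (nat \<Rightarrow> nat) set" where
  "factorizations k g \<beta> =
     {z. (\<forall>i. i \<notin> {1..k} \<longrightarrow> z i = 0) \<and> \<beta> = (\<Sum>i=1..k. int (z i) * g i)}"

definition weighted_length :: "nat \<Rightarrow> (nat \<Rightarrow> nat) \<Rightarrow> (nat \<Rightarrow> nat) \<Rightarrow> nat" where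
  "weighted_length k w z = (\<Sum>i=1..k. w i * z i)"

text \<open>The simple graph on the factorizations, encoded as a symmetric loop-free digraph.\<close>

definition factorization_graph ::
    "nat \<Rightarrow> (nat \<Rightarrow> int) \<Rightarrow> int \<Rightarrow> (nat \<Rightarrow> nat, (nat \<Rightarrow> nat) \<times> (nat \<Rightarrow> nat)) pre_digraph" where
  "factorization_graph k g \<beta> = with_proj
     \<lparr> pverts = factorizations k g \<beta>,
       parcs = {(z, z'). z \<in> factorizations k g \<beta> \<and> z' \<in> factorizations k g \<beta> \<and> z \<noteq> z' \<and>
                         (\<exists>i\<in>{1..k}. z i > 0 \<and> z' i > 0)} \<rparr>"

text \<open>
  As the graph is symmetric, its strongly connected components are the connected components
  of the underlying undirected graph (see \<open>factorization_component_conv\<close>).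
\<close>

definition factorization_component ::
    "nat \<Rightarrow> (nat \<Rightarrow> int) \<Rightarrow> int \<Rightarrow> (nat \<Rightarrow> nat) \<Rightarrow> (nat \<Rightarrow> nat) set" where
  "factorization_component k g \<beta> z = pre_digraph.scc_of (factorization_graph k g \<beta>) z"

definition betti_element :: "nat \<Rightarrow> (nat \<Rightarrow> int) \<Rightarrow> int \<Rightarrow> bool" where
  "betti_element k g \<beta> \<longleftrightarrow>
     \<beta> \<in> generated_monoid k g \<and> \<not> connected (factorization_graph k g \<beta>)"

definition shifted_gens :: "(nat \<Rightarrow> nat) \<Rightarrow> (nat \<Rightarrow> nat) \<Rightarrow> int \<Rightarrow> nat \<Rightarrow> int" where
  "shifted_gens w r n i = int (w i) * n + int (r i)"

lemma symmetric_factorization_graph: "symmetric (factorization_graph k g \<beta>)"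
  by (auto simp: symmetric_def factorization_graph_def intro!: symI)

lemma factorization_component_conv:
  "factorization_component k g \<beta> z = {z'. z \<rightarrow>\<^sup>*\<^bsub>factorization_graph k g \<beta>\<^esub> z'}"
  using symmetric_reachable[OF symmetric_factorization_graph]
  unfolding factorization_component_def pre_digraph.scc_of_def by blast

end

theory Submission
  imports Defs
begin

text \<open>
  Write \<open>v\<^sub>i = (w i, r i)\<close>. A factorization \<open>y\<close> of \<open>\<beta>\<close> satisfies
  \<open>\<beta> = n * |y|\<^sub>w + r \<cdot> y\<close>, so that replacing a part \<open>u \<le> y\<close> by a vector with the same value of
  \<open>\<Sum>u\<^sub>i v\<^sub>i\<close> gives a factorization of \<open>\<beta>\<close> of the same weighted length. The slopes \<open>r i / w i\<close>
  are nondecreasing, hence all \<open>v\<^sub>i\<close> lie in the cone spanned by \<open>v\<^sub>1\<close> and \<open>v\<^sub>k\<close>. Let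
  \<open>D = w\<^sub>1 r\<^sub>k - w\<^sub>k r\<^sub>1\<close>; call the units of \<open>y\<^sub>i\<close> the copies of \<open>i\<close> in \<open>y\<close>.

  By the pigeonhole principle, among any \<open>w\<^sub>1 D\<close> copies some nonempty part \<open>u\<close> has its sum in
  the lattice generated by \<open>v\<^sub>1\<close> and \<open>v\<^sub>k\<close> (\<open>exists_part_in_sublattice\<close>), so that
  \<open>\<Sum>u\<^sub>i v\<^sub>i = a v\<^sub>1 + b v\<^sub>k\<close> with \<open>a, b \<ge> 0\<close>. If all copies used have slope below that of \<open>v\<^sub>k\<close>,
  then \<open>a > 0\<close>; if they all have slope above that of \<open>v\<^sub>1\<close>, then \<open>b > 0\<close>. As soon as one more
  such copy is available, it survives the replacement of \<open>u\<close> by \<open>a v\<^sub>1 + b v\<^sub>k\<close>, so that the new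
  factorization is equal or adjacent to the old one and contains \<open>v\<^sub>1\<close>, respectively \<open>v\<^sub>k\<close>
  (\<open>exchange_for_extreme_generators\<close>).

  Two weighted lengths \<open>L > L'\<close> of factorizations of the same \<open>\<beta>\<close> supply the copies: the
  difference of the values \<open>r \<cdot> y\<close> is \<open>n (L - L')\<close>, and as \<open>n\<close> is large this forces every
  factorization of length \<open>L\<close> to have more than \<open>w\<^sub>1 D\<close> copies of low slope,
  that is, below the slope of \<open>v\<^sub>k\<close> (\<open>many_copies_of_low_slope\<close>) and every factorization of length \<open>L'\<close> to have more than \<open>w\<^sub>1 D\<close>
  copies of high slope, that is, above the slope of \<open>v\<^sub>1\<close> (\<open>many_copies_of_high_slope\<close>). Hence every factorization of length \<open>L\<close>
  is equal or adjacent to one that contains \<open>v\<^sub>1\<close>, and the factorizations that contain \<open>v\<^sub>1\<close> are pairwise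
  adjacent; in the same way with \<open>L'\<close> and \<open>v\<^sub>k\<close>.
\<close>

section \<open>Parts of a vector whose sum lies in a sublattice\<close>

text \<open>
  A vector whose entries sum to at least \<open>M\<close> can be built up one unit at a time; the successive
  stages are the prefix sums to which the pigeonhole principle is applied.
\<close>

lemma exists_unit_step_chain:
  fixes y :: "'a \<Rightarrow> nat"
  assumes "finite S" "M \<le> sum y S"
  shows "\<exists>s. (\<forall>j\<le>M. sum (s j) S = j \<and> s j \<le> y \<and> (\<forall>i. i \<notin> S \<longrightarrow> s j i = 0)) \<and>
             (\<forall>l\<le>M. \<forall>j\<le>l. s j \<le> s l)"
  using assms(2)
proof (induction M)
  case 0
  show ?case
    by (rule exI[of _ "\<lambda>_ _. 0"]) (auto simp: le_fun_def)
next
  case (Suc M)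
  then obtain s where "\<forall>j\<le>M. sum (s j) S = j \<and> s j \<le> y \<and> (\<forall>i. i \<notin> S \<longrightarrow> s j i = 0)"
      "\<forall>l\<le>M. \<forall>j\<le>l. s j \<le> s l"
    by (metis Suc_leD)
  then have s: "\<And>j. j \<le> M \<Longrightarrow> sum (s j) S = j"
      "\<And>j. j \<le> M \<Longrightarrow> s j \<le> y" "\<And>j i. j \<le> M \<Longrightarrow> i \<notin> S \<Longrightarrow> s j i = 0"
      "\<And>j l. l \<le> M \<Longrightarrow> j \<le> l \<Longrightarrow> s j \<le> s l"
    by blast+
  have "sum (s M) S < sum y S"
    using s(1)[of M] Suc.prems by simp
  then obtain i where i: "i \<in> S" "s M i < y i"
    by (meson not_le sum_mono)
  define t where "t = (s M)(i := Suc (s M i))"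
  have t: "sum t S = Suc M" "t \<le> y" "\<And>i. i \<notin> S \<Longrightarrow> t i = 0" "s M \<le> t"
  proof -
    have "sum t S = Suc (s M i) + sum (s M) (S - {i})"
      unfolding t_def using i(1) assms(1) by (simp add: sum.remove[of S i])
    also have "\<dots> = Suc M"
      using i(1) assms(1) s(1)[of M] by (simp add: sum.remove[of S i])
    finally show "sum t S = Suc M" .
    show "t \<le> y" "\<And>i. i \<notin> S \<Longrightarrow> t i = 0" "s M \<le> t"
      using s(2,3)[of M] i by (auto simp: t_def le_fun_def)
  qed
  have mono: "s j \<le> t" if "j \<le> M" for j
    using s(4)[of M j] that t(4) by (simp add: order_trans)
  show ?case
    by (rule exI[of _ "s(Suc M := t)"])
       (use s t mono in \<open>auto simp: le_Suc_eq\<close>)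
qed

text \<open>
  The pairs \<open>(p * q, c * q + d * e)\<close> form a sublattice of index \<open>p * d\<close>, and the residues used
  as pigeonholes below name its cosets. Among \<open>p * d + 1\<close> prefix sums two lie in the same
  coset, and the part of \<open>y\<close> between them is the required one.
\<close>

lemma exists_part_in_sublattice:
  fixes y w r :: "nat \<Rightarrow> nat" and p d c :: int
  assumes "finite S" "p > 0" "d > 0" "p * d \<le> int (sum y S)"
  shows "\<exists>u q. u \<le> y \<and> (\<forall>i. i \<notin> S \<longrightarrow> u i = 0) \<and> 0 < sum u S \<and> int (sum u S) \<le> p * d \<and>
               (\<Sum>i\<in>S. int (w i) * int (u i)) = p * q \<and>
               d dvd (\<Sum>i\<in>S. int (r i) * int (u i)) - c * q"
proof -
  define M where "M = nat (p * d)"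
  have M: "int M = p * d"
    using assms(2,3) by (simp add: M_def)
  have "M \<le> sum y S"
    using assms(4) M by linarith
  then obtain s where "\<forall>j\<le>M. sum (s j) S = j \<and> s j \<le> y \<and> (\<forall>i. i \<notin> S \<longrightarrow> s j i = 0)"
      "\<forall>l\<le>M. \<forall>j\<le>l. s j \<le> s l"
    using exists_unit_step_chain[OF assms(1)] by metis
  then have s: "\<And>j. j \<le> M \<Longrightarrow> sum (s j) S = j"
      "\<And>j. j \<le> M \<Longrightarrow> s j \<le> y" "\<And>j i. j \<le> M \<Longrightarrow> i \<notin> S \<Longrightarrow> s j i = 0"
      "\<And>j l. l \<le> M \<Longrightarrow> j \<le> l \<Longrightarrow> s j \<le> s l"
    by blast+
  define X where "X j = (\<Sum>i\<in>S. int (w i) * int (s j i))" for j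
  define Y where "Y j = (\<Sum>i\<in>S. int (r i) * int (s j i))" for j
  define h where "h j = (X j mod p, (Y j - c * (X j div p)) mod d)" for j
  have "h ` {..M} \<subseteq> {0..<p} \<times> {0..<d}"
    using assms(2,3) by (auto simp: h_def)
  then have "card (h ` {..M}) \<le> card ({0..<p} \<times> {0..<d})"
    by (intro card_mono) auto
  also have "\<dots> = M"
    using assms(2,3) by (simp add: card_cartesian_product M_def nat_mult_distrib)
  finally have "\<not> inj_on h {..M}"
    using pigeonhole[of h "{..M}"] by simp
  then obtain j l where jl: "j < l" "l \<le> M" "h j = h l"
    unfolding inj_on_def by (metis atMost_iff linorder_neqE_nat)
  define u where "u i = s l i - s j i" for i
  define q where "q = X l div p - X j div p"
  have u: "int (u i) = int (s l i) - int (s j i)" for i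
    using s(4)[of l j] jl by (simp add: u_def le_fun_def of_nat_diff)
  have "int (sum u S) = int (sum (s l) S) - int (sum (s j) S)"
    by (simp add: u sum_subtractf)
  then have total: "int (sum u S) = int l - int j"
    using s(1) jl by simp
  have "X l - X j = p * q"
  proof -
    have "X l mod p = X j mod p"
      using jl(3) by (simp add: h_def)
    then show ?thesis
      using mult_div_mod_eq[of p "X l"] mult_div_mod_eq[of p "X j"]
      unfolding q_def right_diff_distrib by linarith
  qed
  then have W: "(\<Sum>i\<in>S. int (w i) * int (u i)) = p * q"
    by (simp add: u X_def sum_subtractf right_diff_distrib)
  have "d dvd (Y l - c * (X l div p)) - (Y j - c * (X j div p))"
    using jl(3) by (simp add: h_def flip: mod_eq_dvd_iff)
  also have "\<dots> = (Y l - Y j) - c * q"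
    by (simp add: q_def algebra_simps)
  finally have "d dvd (\<Sum>i\<in>S. int (r i) * int (u i)) - c * q"
    by (simp add: u Y_def sum_subtractf right_diff_distrib)
  moreover have "u \<le> y"
    using s(2)[of l] jl(2) by (auto simp: u_def le_fun_def intro: le_trans[OF diff_le_self])
  moreover have "\<forall>i. i \<notin> S \<longrightarrow> u i = 0"
    using s(3)[of l] jl(2) by (simp add: u_def)
  moreover have "0 < sum u S" "int (sum u S) \<le> p * d"
    using total jl(1,2) M by linarith+
  ultimately show ?thesis
    using W by blast
qed

section \<open>Factorizations and their graph\<close>

lemma factorizations_shifted_gens_iff:
  "y \<in> factorizations k (shifted_gens w r n) \<beta> \<longleftrightarrow>
     (\<forall>i. i \<notin> {1..k} \<longrightarrow> y i = 0) \<and>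
     \<beta> = n * int (weighted_length k w y) + (\<Sum>i=1..k. int (r i) * int (y i))"
proof -
  have "(\<Sum>i=1..k. int (y i) * shifted_gens w r n i)
          = n * int (weighted_length k w y) + (\<Sum>i=1..k. int (r i) * int (y i))"
    by (simp add: shifted_gens_def weighted_length_def algebra_simps sum.distrib sum_distrib_left)
  then show ?thesis
    by (simp add: factorizations_def)
qed

lemma reachable_if_common_generator:
  assumes "y \<in> factorizations k g \<beta>" "x \<in> factorizations k g \<beta>"
    and "i \<in> {1..k}" "y i > 0" "x i > 0"
  shows "y \<rightarrow>\<^sup>*\<^bsub>factorization_graph k g \<beta>\<^esub> x"
proof (cases "y = x")
  case True
  then show ?thesis
    using assms by (simp add: factorization_graph_def reachable_def rtrancl_on_refl)
next
  case False
  interpret wf_digraph "factorization_graph k g \<beta>"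
    by unfold_locales (auto simp: factorization_graph_def)
  have "y \<rightarrow>\<^bsub>factorization_graph k g \<beta>\<^esub> x"
    using False assms by (auto simp: factorization_graph_def arcs_ends_def arc_to_ends_def)
  then show ?thesis by blast
qed

text \<open>
  The factorizations in which a fixed generator \<open>e\<close> occurs form a clique, which serves as a hub
  for \<open>C\<close>.
\<close>

lemma subset_component_if_adjacent_to_clique:
  assumes "C \<subseteq> factorizations k g \<beta>" "e \<in> {1..k}" "z \<in> C"
    and hub: "\<And>y. y \<in> C \<Longrightarrow> \<exists>x \<in> factorizations k g \<beta>. x e > 0 \<and> (\<exists>i\<in>{1..k}. y i > 0 \<and> x i > 0)"
  shows "C \<subseteq> factorization_component k g \<beta> z"
proof
  fix y assume y: "y \<in> C"
  interpret wf_digraph "factorization_graph k g \<beta>"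
    by unfold_locales (auto simp: factorization_graph_def)
  obtain x i where x: "x \<in> factorizations k g \<beta>" "x e > 0" "i \<in> {1..k}" "y i > 0" "x i > 0"
    using hub[OF y] by blast
  obtain x' j where x': "x' \<in> factorizations k g \<beta>" "x' e > 0" "j \<in> {1..k}" "z j > 0" "x' j > 0"
    using hub[OF assms(3)] by blast
  have "z \<rightarrow>\<^sup>*\<^bsub>factorization_graph k g \<beta>\<^esub> x'"
    using reachable_if_common_generator[of z _ _ _ x' j] assms(1,3) x' by blast
  also have "x' \<rightarrow>\<^sup>*\<^bsub>factorization_graph k g \<beta>\<^esub> x"
    using reachable_if_common_generator[of x' _ _ _ x e] assms(2) x x' by blast
  also have "x \<rightarrow>\<^sup>*\<^bsub>factorization_graph k g \<beta>\<^esub> y"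
    using reachable_if_common_generator[of x _ _ _ y i] assms(1) y x by blast
  finally show "y \<in> factorization_component k g \<beta> z"
    by (simp add: factorization_component_conv)
qed

section \<open>Exchanging generators for those of extreme slope\<close>

text \<open>
  The part \<open>u\<close> provided by the pigeonhole principle has weighted length \<open>w\<^sub>1 q\<close> and
  \<open>r \<cdot> u = r\<^sub>1 q + D e\<close>, that is, its sum is \<open>(q - w\<^sub>k e) v\<^sub>1 + w\<^sub>1 e v\<^sub>k\<close>. By Cramer's rule the two
  coefficients have the signs of \<open>det(\<Sum>u\<^sub>i v\<^sub>i, v\<^sub>k)\<close> and \<open>det(v\<^sub>1, \<Sum>u\<^sub>i v\<^sub>i)\<close>, which are
  nonnegative because the slopes are nondecreasing. The strict inequality in the bound on the number of
  copies leaves a copy that \<open>y\<close> and the new factorization share.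
\<close>

lemma exchange_for_extreme_generators:
  fixes k :: nat and w r y :: "nat \<Rightarrow> nat" and n \<beta> :: int
  assumes "k \<ge> 1" "w 1 > 0"
    and low: "\<And>i. i \<in> {1..k} \<Longrightarrow> r 1 * w i \<le> r i * w 1"
    and high: "\<And>i. i \<in> {1..k} \<Longrightarrow> r i * w k \<le> r k * w i"
    and D: "D = int (w 1) * int (r k) - int (w k) * int (r 1)" "D > 0"
    and y: "y \<in> factorizations k (shifted_gens w r n) \<beta>"
    and S: "S \<subseteq> {1..k}" "int (w 1) * D < int (sum y S)"
  shows "\<exists>x \<in> factorizations k (shifted_gens w r n) \<beta>.
           weighted_length k w x = weighted_length k w y \<and> (\<exists>i\<in>{1..k}. y i > 0 \<and> x i > 0) \<and>
           ((\<forall>i\<in>S. r i * w k < r k * w i) \<longrightarrow> x 1 > 0) \<and>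
           ((\<forall>i\<in>S. r 1 * w i < r i * w 1) \<longrightarrow> x k > 0)"
proof -
  have fin: "finite S"
    using S(1) finite_subset by blast
  obtain u q where u: "u \<le> y" "\<And>i. i \<notin> S \<Longrightarrow> u i = 0" "0 < sum u S"
      "int (sum u S) \<le> int (w 1) * D"
    and W: "(\<Sum>i\<in>S. int (w i) * int (u i)) = int (w 1) * q"
    and "D dvd (\<Sum>i\<in>S. int (r i) * int (u i)) - int (r 1) * q"
    using exists_part_in_sublattice[OF fin, of "int (w 1)" D y w r "int (r 1)"] assms(2) D(2) S(2)
    by (auto simp: less_imp_le)
  then obtain e where "(\<Sum>i\<in>S. int (r i) * int (u i)) - int (r 1) * q = D * e"
    by (auto simp: dvd_def)
  then have R: "(\<Sum>i\<in>S. int (r i) * int (u i)) = int (r 1) * q + D * e"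
    by simp
  define a b where "a = q - int (w k) * e" and "b = int (w 1) * e"
  have aD: "D * a = (\<Sum>i\<in>S. (int (r k) * int (w i) - int (r i) * int (w k)) * int (u i))"
  proof -
    have "(\<Sum>i\<in>S. (int (r k) * int (w i) - int (r i) * int (w k)) * int (u i))
        = int (r k) * (\<Sum>i\<in>S. int (w i) * int (u i)) - int (w k) * (\<Sum>i\<in>S. int (r i) * int (u i))"
      by (simp add: sum_distrib_left sum_subtractf algebra_simps)
    also have "\<dots> = D * a"
      unfolding W R a_def D(1) by (simp add: algebra_simps)
    finally show ?thesis by simp
  qed
  have bD: "D * b = (\<Sum>i\<in>S. (int (r i) * int (w 1) - int (r 1) * int (w i)) * int (u i))"
  proof -
    have "(\<Sum>i\<in>S. (int (r i) * int (w 1) - int (r 1) * int (w i)) * int (u i))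
        = int (w 1) * (\<Sum>i\<in>S. int (r i) * int (u i)) - int (r 1) * (\<Sum>i\<in>S. int (w i) * int (u i))"
      by (simp add: sum_distrib_left sum_subtractf algebra_simps)
    also have "\<dots> = D * b"
      unfolding W R b_def by (simp add: algebra_simps)
    finally show ?thesis by simp
  qed
  have low': "int (r 1) * int (w i) \<le> int (r i) * int (w 1)" if "i \<in> S" for i
    using low[of i] that S(1) by (metis of_nat_le_iff of_nat_mult subsetD)
  have high': "int (r i) * int (w k) \<le> int (r k) * int (w i)" if "i \<in> S" for i
    using high[of i] that S(1) by (metis of_nat_le_iff of_nat_mult subsetD)
  have "D * a \<ge> 0" "D * b \<ge> 0"
    unfolding aD bD using low' high' by (auto intro!: sum_nonneg)
  then have ab: "a \<ge> 0" "b \<ge> 0"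
    using D(2) by (simp_all add: zero_le_mult_iff)
  obtain i0 where i0: "i0 \<in> S" "u i0 > 0"
    using u(3) by (metis gr0I sum.neutral less_irrefl)
  have a_pos: "a > 0" if *: "\<forall>i\<in>S. r i * w k < r k * w i"
  proof -
    have "int (r i0) * int (w k) < int (r k) * int (w i0)"
      using * i0(1) by (metis of_nat_less_iff of_nat_mult)
    then have "D * a > 0"
      unfolding aD using fin i0 high' by (intro sum_pos2[of S i0]) auto
    then show ?thesis using D(2) by (simp add: zero_less_mult_iff)
  qed
  have b_pos: "b > 0" if *: "\<forall>i\<in>S. r 1 * w i < r i * w 1"
  proof -
    have "int (r 1) * int (w i0) < int (r i0) * int (w 1)"
      using * i0(1) by (metis of_nat_less_iff of_nat_mult)
    then have "D * b > 0"
      unfolding bD using fin i0 low' by (intro sum_pos2[of S i0]) auto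
    then show ?thesis using D(2) by (simp add: zero_less_mult_iff)
  qed
  define x where "x i = y i - u i + (if i = 1 then nat a else 0) + (if i = k then nat b else 0)" for i
  have x: "int (x i) = int (y i) - int (u i) + (if i = 1 then a else 0) + (if i = k then b else 0)" for i
    using le_funD[OF u(1), of i] ab by (auto simp: x_def)
  have sums: "(\<Sum>i=1..k. int (f i) * int (x i)) = (\<Sum>i=1..k. int (f i) * int (y i))
      - (\<Sum>i\<in>S. int (f i) * int (u i)) + int (f 1) * a + int (f k) * b" for f :: "nat \<Rightarrow> nat"
  proof -
    have "(\<Sum>i=1..k. int (f i) * int (x i)) = (\<Sum>i=1..k. int (f i) * int (y i)
        - int (f i) * int (u i) + (if i = 1 then int (f i) * a else 0) + (if i = k then int (f i) * b else 0))"
      by (intro sum.cong) (auto simp: x algebra_simps)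
    also have "\<dots> = (\<Sum>i=1..k. int (f i) * int (y i)) - (\<Sum>i=1..k. int (f i) * int (u i))
        + int (f 1) * a + int (f k) * b"
      using assms(1) by (simp add: sum.distrib sum_subtractf)
    also have "(\<Sum>i=1..k. int (f i) * int (u i)) = (\<Sum>i\<in>S. int (f i) * int (u i))"
      using S(1) u(2) by (intro sum.mono_neutral_right) auto
    finally show ?thesis .
  qed
  have "int (weighted_length k w x) = int (weighted_length k w y)"
    using sums[of w] unfolding weighted_length_def W a_def b_def by (simp add: algebra_simps)
  then have len: "weighted_length k w x = weighted_length k w y"
    by simp
  have "(\<Sum>i=1..k. int (r i) * int (x i)) = (\<Sum>i=1..k. int (r i) * int (y i))"
    using sums[of r] unfolding R a_def b_def D(1) by (simp add: algebra_simps)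
  moreover have "\<forall>i. i \<notin> {1..k} \<longrightarrow> x i = 0"
    using y assms(1) by (auto simp: factorizations_shifted_gens_iff x_def)
  ultimately have fac: "x \<in> factorizations k (shifted_gens w r n) \<beta>"
    using y len by (simp add: factorizations_shifted_gens_iff)
  have "sum u S < sum y S"
    using u(4) S(2) by linarith
  then obtain i where i: "i \<in> S" "u i < y i"
    by (meson not_le sum_mono)
  then have "i \<in> {1..k}" "y i > 0" "x i > 0"
    using S(1) by (auto simp: x_def)
  moreover have "x 1 > 0" if "a > 0"
    using that by (simp add: x_def)
  moreover have "x k > 0" if "b > 0"
    using that by (simp add: x_def)
  ultimately show ?thesis
    using fac len a_pos b_pos by (intro bexI[of _ x]) auto
qed

section \<open>Abundance of low and high slopes\<close>

text \<open>
  For the longer factorization \<open>z\<close>, the linear form \<open>r\<^sub>k |z|\<^sub>w - w\<^sub>k (r \<cdot> z)\<close> vanishes on \<open>v\<^sub>k\<close> and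
  exceeds its value at \<open>z'\<close>, which is nonnegative, by at least \<open>w\<^sub>k n\<close>. Each copy of low slope
  contributes at most \<open>R W\<close> to it, and other copies contribute nothing.
\<close>

lemma many_copies_of_low_slope:
  fixes k W R :: nat and w r z z' :: "nat \<Rightarrow> nat" and n \<beta> :: int
  assumes "w k > 0" "n \<ge> 0"
    and slope: "\<And>i. i \<in> {1..k} \<Longrightarrow> r i * w k \<le> r k * w i"
    and bounds: "\<And>i. i \<in> {1..k} \<Longrightarrow> w i \<le> W" "r k \<le> R"
    and z: "z \<in> factorizations k (shifted_gens w r n) \<beta>"
    and z': "z' \<in> factorizations k (shifted_gens w r n) \<beta>"
    and less: "weighted_length k w z' < weighted_length k w z"
  shows "n \<le> int (R * W * sum z {i \<in> {1..k}. r i * w k < r k * w i})"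
proof -
  define S where "S = {i \<in> {1..k}. r i * w k < r k * w i}"
  define h where "h x = (\<Sum>i=1..k. (int (r k) * int (w i) - int (r i) * int (w k)) * int (x i))"
    for x :: "nat \<Rightarrow> nat"
  define L L' where "L = int (weighted_length k w z)" and "L' = int (weighted_length k w z')"
  have h: "h x = int (r k) * int (weighted_length k w x)
      - int (w k) * (\<Sum>i=1..k. int (r i) * int (x i))" for x
    by (simp add: h_def weighted_length_def sum_distrib_left sum_subtractf algebra_simps)
  have "h z' \<ge> 0"
    unfolding h_def using slope by (intro sum_nonneg) (auto simp flip: of_nat_mult)
  have "n * 1 \<le> (int (w k) * n + int (r k)) * (L - L')"
  proof (rule mult_mono)
    have "1 * n \<le> int (w k) * n"
      using assms(1,2) by (intro mult_right_mono) auto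
    then show "n \<le> int (w k) * n + int (r k)" by simp
  qed (use less assms(2) in \<open>auto simp: L_def L'_def\<close>)
  also have "\<dots> = h z - h z'"
  proof -
    have "(\<Sum>i=1..k. int (r i) * int (z i)) = \<beta> - n * L"
         "(\<Sum>i=1..k. int (r i) * int (z' i)) = \<beta> - n * L'"
      using z z' by (auto simp: factorizations_shifted_gens_iff L_def L'_def)
    then show ?thesis
      unfolding h by (simp add: right_diff_distrib left_diff_distrib distrib_right flip: L_def L'_def)
  qed
  also have "\<dots> \<le> h z"
    using \<open>h z' \<ge> 0\<close> by simp
  also have "h z = (\<Sum>i\<in>S. (int (r k) * int (w i) - int (r i) * int (w k)) * int (z i))"
  proof -
    have "int (r k) * int (w i) = int (r i) * int (w k)" if "i \<in> {1..k} - S" for i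
      using that slope[of i] by (auto simp: S_def simp flip: of_nat_mult)
    then show ?thesis
      unfolding h_def by (intro sum.mono_neutral_right) (auto simp: S_def)
  qed
  also have "\<dots> \<le> (\<Sum>i\<in>S. int (R * W) * int (z i))"
  proof (intro sum_mono mult_right_mono)
    fix i assume "i \<in> S"
    then have "r k * w i \<le> R * W"
      using bounds by (intro mult_mono) (auto simp: S_def)
    then have "int (r k) * int (w i) \<le> int (R * W)"
      by (metis of_nat_le_iff of_nat_mult)
    then show "int (r k) * int (w i) - int (r i) * int (w k) \<le> int (R * W)"
      by (smt (verit) of_nat_0_le_iff mult_nonneg_nonneg)
  qed simp
  also have "\<dots> = int (R * W * sum z S)"
    by (simp add: sum_distrib_left)
  finally show ?thesis
    by (simp add: S_def)
qed

text \<open>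
  The same argument with the linear form \<open>w\<^sub>1 (r \<cdot> z') - r\<^sub>1 |z'|\<^sub>w\<close>, which vanishes on \<open>v\<^sub>1\<close>. It
  exceeds its value at \<open>z\<close> by at least \<open>w\<^sub>1 n\<close>, and a copy of high slope contributes at most
  \<open>w\<^sub>1 R\<close>, so that \<open>w\<^sub>1\<close> cancels.
\<close>

lemma many_copies_of_high_slope:
  fixes k R :: nat and w r z z' :: "nat \<Rightarrow> nat" and n \<beta> :: int
  assumes "w 1 > 0" "n \<ge> 0"
    and slope: "\<And>i. i \<in> {1..k} \<Longrightarrow> r 1 * w i \<le> r i * w 1"
    and bound: "\<And>i. i \<in> {1..k} \<Longrightarrow> r i \<le> R"
    and z: "z \<in> factorizations k (shifted_gens w r n) \<beta>"
    and z': "z' \<in> factorizations k (shifted_gens w r n) \<beta>"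
    and less: "weighted_length k w z' < weighted_length k w z"
  shows "n \<le> int (R * sum z' {i \<in> {1..k}. r 1 * w i < r i * w 1})"
proof -
  define S where "S = {i \<in> {1..k}. r 1 * w i < r i * w 1}"
  define h where "h x = (\<Sum>i=1..k. (int (r i) * int (w 1) - int (r 1) * int (w i)) * int (x i))"
    for x :: "nat \<Rightarrow> nat"
  define L L' where "L = int (weighted_length k w z)" and "L' = int (weighted_length k w z')"
  have h: "h x = int (w 1) * (\<Sum>i=1..k. int (r i) * int (x i))
      - int (r 1) * int (weighted_length k w x)" for x
    by (simp add: h_def weighted_length_def sum_distrib_left sum_subtractf algebra_simps)
  have "h z \<ge> 0"
    unfolding h_def using slope by (intro sum_nonneg) (auto simp flip: of_nat_mult)
  have "(int (w 1) * n) * 1 \<le> (int (w 1) * n + int (r 1)) * (L - L')"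
    by (rule mult_mono) (use less assms(2) in \<open>auto simp: L_def L'_def\<close>)
  also have "\<dots> = h z' - h z"
  proof -
    have "(\<Sum>i=1..k. int (r i) * int (z i)) = \<beta> - n * L"
         "(\<Sum>i=1..k. int (r i) * int (z' i)) = \<beta> - n * L'"
      using z z' by (auto simp: factorizations_shifted_gens_iff L_def L'_def)
    then show ?thesis
      unfolding h by (simp add: right_diff_distrib left_diff_distrib distrib_right flip: L_def L'_def)
  qed
  also have "\<dots> \<le> h z'"
    using \<open>h z \<ge> 0\<close> by simp
  also have "h z' = (\<Sum>i\<in>S. (int (r i) * int (w 1) - int (r 1) * int (w i)) * int (z' i))"
  proof -
    have "int (r i) * int (w 1) = int (r 1) * int (w i)" if "i \<in> {1..k} - S" for i
      using that slope[of i] by (auto simp: S_def simp flip: of_nat_mult)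
    then show ?thesis
      unfolding h_def by (intro sum.mono_neutral_right) (auto simp: S_def)
  qed
  also have "\<dots> \<le> (\<Sum>i\<in>S. int (w 1) * int R * int (z' i))"
  proof (intro sum_mono mult_right_mono)
    fix i assume "i \<in> S"
    then have "int (r i) * int (w 1) \<le> int (w 1) * int R"
      using bound[of i] by (simp add: S_def mult.commute[of "int (r i)"] mult_left_mono)
    then show "int (r i) * int (w 1) - int (r 1) * int (w i) \<le> int (w 1) * int R"
      by (smt (verit) of_nat_0_le_iff mult_nonneg_nonneg)
  qed simp
  also have "\<dots> = int (w 1) * int (R * sum z' S)"
    by (simp add: sum_distrib_left mult.assoc)
  finally show ?thesis
    using assms(1) by (simp add: S_def)
qed

section \<open>Betti elements of shifted monoids\<close>

theorem theorem4p3: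
  fixes k W R :: nat and r w :: "nat \<Rightarrow> nat" and n \<beta> :: int and g :: "nat \<Rightarrow> int"
    and z z' :: "nat \<Rightarrow> nat"
  assumes "k \<ge> 1"
    and "\<And>i. i \<in> {1..k} \<Longrightarrow> w i \<ge> 1"
    and "\<And>i j. 1 \<le> i \<Longrightarrow> i \<le> j \<Longrightarrow> j \<le> k \<Longrightarrow> real (r i) / real (w i) \<le> real (r j) / real (w j)"
    and "r 1 < w 1"
    and "W = Max (w ` {1..k})"
    and "R = Max (r ` {1..k})"
    and "n > int ((w 1)\<^sup>2 * W * R\<^sup>2)"
    and "g = shifted_gens w r n"
    and "betti_element k g \<beta>"
    and "z \<in> factorizations k g \<beta>"
    and "z' \<in> factorizations k g \<beta>"
    and "factorization_component k g \<beta> z \<noteq> factorization_component k g \<beta> z'"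
    and "weighted_length k w z > weighted_length k w z'"
  shows "({y \<in> factorizations k g \<beta>. weighted_length k w y = weighted_length k w z}
             \<subseteq> factorization_component k g \<beta> z
          \<and> {y \<in> factorizations k g \<beta>. weighted_length k w y = weighted_length k w z'}
             \<subseteq> factorization_component k g \<beta> z')
      \<and> (\<exists>y \<in> factorizations k g \<beta>. weighted_length k w y = weighted_length k w z \<and> y 1 > 0)
      \<and> (\<exists>y' \<in> factorizations k g \<beta>. weighted_length k w y' = weighted_length k w z' \<and> y' k > 0)"
proof -
  let ?F = "factorizations k g \<beta>" and ?len = "weighted_length k w"
  have g: "g = shifted_gens w r n" by fact
  have ends: "1 \<in> {1..k}" "k \<in> {1..k}"
    using \<open>k \<ge> 1\<close> by auto
  have w_pos: "w i > 0" if "i \<in> {1..k}" for i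
    using assms(2)[OF that] by simp
  have w_le: "w i \<le> W" and r_le: "r i \<le> R" if "i \<in> {1..k}" for i
    using that assms(5,6) by auto
  have slope: "r i * w j \<le> r j * w i" if "1 \<le> i" "i \<le> j" "j \<le> k" for i j
  proof -
    have "real (r i) * real (w j) \<le> real (r j) * real (w i)"
      using assms(3)[OF that] w_pos[of i] w_pos[of j] that by (simp add: field_simps)
    then show ?thesis
      by (metis of_nat_le_iff of_nat_mult)
  qed
  have low: "r 1 * w i \<le> r i * w 1" and high: "r i * w k \<le> r k * w i" if "i \<in> {1..k}" for i
    using slope[of 1 i] slope[of i k] that by auto
  have n: "n > int ((w 1)\<^sup>2 * W * R\<^sup>2)" "n \<ge> 0"
    using assms(7) of_nat_0_le_iff[of "(w 1)\<^sup>2 * W * R\<^sup>2", where 'a = int] by linarith+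
  define D where "D = int (w 1) * int (r k) - int (w k) * int (r 1)"
  have "D \<le> int (w 1) * int R"
  proof -
    have "int (w 1) * int (r k) \<le> int (w 1) * int R"
      using r_le[OF ends(2)] by (intro mult_left_mono) auto
    then show ?thesis
      unfolding D_def by (smt (verit) of_nat_0_le_iff mult_nonneg_nonneg)
  qed
  then have "int (w 1) * D \<le> int (w 1) * (int (w 1) * int R)"
    by (intro mult_left_mono) auto
  then have D_le: "int (w 1) * D \<le> int ((w 1)\<^sup>2 * R)"
    by (simp add: power2_eq_square mult.assoc)
  have D_pos: "D > 0" if "i \<in> {1..k}" "r i * w k < r k * w i \<or> r 1 * w i < r i * w 1" for i
  proof (rule ccontr)
    \<comment> \<open>If \<open>v\<^sub>1\<close> and \<open>v\<^sub>k\<close> have the same slope, then so have all vectors between them.\<close>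
    assume "\<not> D > 0"
    then have "real (r k) * real (w 1) \<le> real (r 1) * real (w k)"
      by (simp add: D_def mult.commute flip: of_nat_mult)
    then have "real (r k) / real (w k) \<le> real (r 1) / real (w 1)"
      using w_pos[OF ends(1)] w_pos[OF ends(2)] by (simp add: field_simps)
    then have "real (r i) / real (w i) = real (r 1) / real (w 1)"
              "real (r i) / real (w i) = real (r k) / real (w k)"
      using assms(3)[of 1 i] assms(3)[of i k] that(1) by auto
    moreover have "real (w i) \<noteq> 0" "real (w 1) \<noteq> 0" "real (w k) \<noteq> 0"
      using w_pos[OF that(1)] w_pos[OF ends(1)] w_pos[OF ends(2)] by simp_all
    ultimately have "real (r i) * real (w 1) = real (r 1) * real (w i)"
                    "real (r i) * real (w k) = real (r k) * real (w i)"
      by (metis frac_eq_eq)+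
    then show False
      using that(2) by (metis less_irrefl of_nat_eq_iff of_nat_mult)
  qed
  have long: "\<exists>x\<in>?F. ?len x = ?len y \<and> (\<exists>i\<in>{1..k}. y i > 0 \<and> x i > 0) \<and> x 1 > 0"
    if y: "y \<in> ?F" "?len y = ?len z" for y
  proof -
    define S where "S = {i \<in> {1..k}. r i * w k < r k * w i}"
    have "n \<le> int (R * W * sum y S)"
      unfolding S_def
      by (rule many_copies_of_low_slope[where z' = z' and \<beta> = \<beta>])
         (use y assms w_pos ends n(2) high w_le r_le in \<open>auto simp: g\<close>)
    then have "int ((w 1)\<^sup>2 * W * R\<^sup>2) < int (R * W * sum y S)"
      using n(1) by linarith
    then have "(R * W) * ((w 1)\<^sup>2 * R) < (R * W) * sum y S"
      unfolding of_nat_less_iff by (simp add: power2_eq_square mult_ac)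
    then have many: "(w 1)\<^sup>2 * R < sum y S"
      by simp
    then obtain i where "i \<in> S"
      by (metis all_not_in_conv sum.empty not_less_zero)
    then have "D > 0"
      using D_pos[of i] by (auto simp: S_def)
    moreover have "int (w 1) * D < int (sum y S)"
      using D_le many by linarith
    moreover have "S \<subseteq> {1..k}" "\<forall>i\<in>S. r i * w k < r k * w i"
      by (auto simp: S_def)
    ultimately show ?thesis
      using exchange_for_extreme_generators[OF assms(1) w_pos[OF ends(1)] low high D_def, of y n \<beta> S] y(1)
      unfolding g by blast
  qed
  have short: "\<exists>x\<in>?F. ?len x = ?len y \<and> (\<exists>i\<in>{1..k}. y i > 0 \<and> x i > 0) \<and> x k > 0"
    if y: "y \<in> ?F" "?len y = ?len z'" for y
  proof -
    define S where "S = {i \<in> {1..k}. r 1 * w i < r i * w 1}"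
    have "n \<le> int (R * sum y S)"
      unfolding S_def
      by (rule many_copies_of_high_slope[where z = z and \<beta> = \<beta>])
         (use y assms w_pos ends n(2) low r_le in \<open>auto simp: g\<close>)
    then have "int ((w 1)\<^sup>2 * W * R\<^sup>2) < int (R * sum y S)"
      using n(1) by linarith
    then have "R * ((w 1)\<^sup>2 * R * W) < R * sum y S"
      unfolding of_nat_less_iff by (simp add: power2_eq_square mult_ac)
    then have "(w 1)\<^sup>2 * R * W < sum y S"
      by simp
    moreover have "W \<ge> 1"
      using w_pos[OF ends(1)] w_le[OF ends(1)] by simp
    then have "(w 1)\<^sup>2 * R * 1 \<le> (w 1)\<^sup>2 * R * W"
      by (intro mult_left_mono) auto
    ultimately have many: "(w 1)\<^sup>2 * R < sum y S"
      by linarith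
    then obtain i where "i \<in> S"
      by (metis all_not_in_conv sum.empty not_less_zero)
    then have "D > 0"
      using D_pos[of i] by (auto simp: S_def)
    moreover have "int (w 1) * D < int (sum y S)"
      using D_le many by linarith
    moreover have "S \<subseteq> {1..k}" "\<forall>i\<in>S. r 1 * w i < r i * w 1"
      by (auto simp: S_def)
    ultimately show ?thesis
      using exchange_for_extreme_generators[OF assms(1) w_pos[OF ends(1)] low high D_def, of y n \<beta> S] y(1)
      unfolding g by blast
  qed
  have "{y \<in> ?F. ?len y = ?len z} \<subseteq> factorization_component k g \<beta> z"
    by (rule subset_component_if_adjacent_to_clique[OF _ ends(1)])
       (use long assms(10) in blast)+
  moreover have "{y \<in> ?F. ?len y = ?len z'} \<subseteq> factorization_component k g \<beta> z'"
    by (rule subset_component_if_adjacent_to_clique[OF _ ends(2)])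
       (use short assms(11) in blast)+
  ultimately show ?thesis
    using long[OF assms(10)] short[OF assms(11)] by blast
qed

end
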